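(* Let $l$ be a positive integer and let $\mathcal{T}=\{(0\,|\,c^{(t)}) : t\in T\}$ be a set of $l$-multipartition data, each with first entry $0$, where $c^{(t)}=(c^{(t)}_1,\dots,c^{(t)}_l)\in\mathbb{Z}^l$. Let $\mathcal{C}_{\mathcal{T}}=\bigcap_{t\in T}\mathcal{C}_{(0\,|\,c^{(t)})}$ (with $\mathcal{C}_{\mathcal{T}}=\mathcal{P}^l$ if $T=\emptyset$). Then $\mathcal{C}_{\mathcal{T}}$ is finite if and only if $g(\mathcal{T})=1$ and $\mathcal{T}$ satisfies condition X.
   Context: A partition is a weakly decreasing sequence $\lambda=(\lambda_1,\lambda_2,\dots)$ of non-negative integers with finite sum; $\mathcal{P}$ is the set of partitions. For $l\in\mathbb{N}$, an $l$-multipartition is an $l$-tuple $\lambda=(\lambda^{(1)},\dots,\lambda^{(l)})$ of partitions; $\mathcal{P}^l$ is the set of these and $\varnothing^l$ the multipartition with all components empty. The nodes of $\lambda$ are the triples $(a,b,k)\in\mathbb{N}^2\times\{1,\dots,l\}$ with $b\le\lambda^{(k)}_a$. An $l$-multipartition datum is a pair $(s\,|\,c)$ with $s\in\{0,1,2,\dots\}$ and $c\in\mathbb{Z}^l$. The $(s\,|\,c)$-residue of a node $(a,b,k)$ is $b-a+c_k+s\mathbb{Z}\in\mathbb{Z}/s\mathbb{Z}$ (for $s=0$ this is the integer $b-a+c_k$). The $(s\,|\,c)$-content of $\lambda$ is the multiset of $(s\,|\,c)$-residues of its nodes. $\lambda$ is an $(s\,|\,c)$-core if no other $l$-multipartition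 has the same $(s\,|\,c)$-content, except that for $s=1$ the set of $(1\,|\,c)$-cores is defined to be $\{\varnothing^l\}$. $\mathcal{C}_{(s|c)}$ denotes the set of $(s\,|\,c)$-cores. For a set $\mathcal{T}=\{(s^{(t)}\,|\,c^{(t)}):t\in T\}$ of $l$-multipartition data, $g(\mathcal{T})$ is the greatest common divisor of the integers in $\{s^{(t)}:t\in T\}\cup\{c^{(t)}_i-c^{(t)}_j-c^{(u)}_i+c^{(u)}_j : t,u\in T,\ 1\le i,j\le l\}$, with $g(\mathcal{T})=0$ if this set is empty or equals $\{0\}$. An index $k\in\{1,\dots,l\}$ is always maximal if $c^{(t)}_k\ge c^{(t)}_j$ for all $t\in T$ and all $j$; sometimes maximal if there is $t\in T$ with $c^{(t)}_k\ge c^{(t)}_j$ for all $j$; always minimal and sometimes minimal are defined in the same way with the inequalities reversed. $\mathcal{T}$ satisfies condition X if there is at least one $k$ which is sometimes maximal but not always maximal, and at least one $k$ which is sometimes minimal but not always minimal. *)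

theory Defs
  imports "HOL-Library.Multiset"
begin

text \<open>
  Rows, columns and components are all numbered from 0. Shifting rows and columns by one leaves
  \<open>b - a\<close> unchanged, so residues agree with those of the usual numbering from 1.
\<close>

type_synonym ptn = "nat \<Rightarrow> nat"

text \<open>A sequence of non-negative integers has finite sum iff only finitely many terms are nonzero.\<close>

definition partitions :: "ptn set" where
  "partitions = {p. antimono p \<and> finite {a. p a \<noteq> 0}}"

definition multipartitions :: "nat \<Rightarrow> ptn list set" where
  "multipartitions l = {\<Lambda>. length \<Lambda> = l \<and> set \<Lambda> \<subseteq> partitions}"

definition empty_multipartition :: "nat \<Rightarrow> ptn list" where
  "empty_multipartition l = replicate l (\<lambda>_. 0)"

definition nodes :: "ptn list \<Rightarrow> (nat \<times> nat \<times> nat) set" where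
  "nodes \<Lambda> = {(a, b, k). k < length \<Lambda> \<and> b < (\<Lambda> ! k) a}"

text \<open>
  A datum \<open>(s | c)\<close> is a pair of a natural number and a list of integers; the list is required
  to have length \<open>l\<close> wherever \<open>l\<close>-multipartition data are meant.
\<close>

type_synonym datum = "nat \<times> int list"

text \<open>
  A class in \<open>\<int>/s\<int>\<close> is encoded by its canonical representative modulo \<open>s\<close>. As
  \<open>x mod 0 = x\<close>, for \<open>s = 0\<close> this is the integer itself.
\<close>

fun residue :: "datum \<Rightarrow> nat \<times> nat \<times> nat \<Rightarrow> int" where
  "residue (s, c) (a, b, k) = (int b - int a + c ! k) mod int s"

text \<open>
  \<^const>\<open>mset_set\<close> of an infinite set is empty, but the node set of a multipartition is finite
  (lemma \<open>finite_nodes\<close> below).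
\<close>

definition content :: "datum \<Rightarrow> ptn list \<Rightarrow> int multiset" where
  "content d \<Lambda> = image_mset (residue d) (mset_set (nodes \<Lambda>))"

lemma finite_nodes:
  assumes "\<Lambda> \<in> multipartitions l"
  shows "finite (nodes \<Lambda>)"
proof -
  have fin: "finite {a. (\<Lambda> ! k) a \<noteq> 0}" if "k < length \<Lambda>" for k
  proof -
    have "\<Lambda> ! k \<in> partitions"
      using assms nth_mem[OF that] by (auto simp: multipartitions_def)
    then show ?thesis by (simp add: partitions_def)
  qed
  have "nodes \<Lambda> \<subseteq> (\<Union>k\<in>{..<length \<Lambda>}. \<Union>a\<in>{a. (\<Lambda> ! k) a \<noteq> 0}.
          (\<lambda>b. (a, b, k)) ` {..<(\<Lambda> ! k) a})"
    by (force simp: nodes_def)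
  then show ?thesis
    by (rule finite_subset) (intro finite_UN_I finite_imageI finite_lessThan fin, simp)
qed

definition cores :: "nat \<Rightarrow> datum \<Rightarrow> ptn list set" where
  "cores l d =
    (if fst d = 1 then {empty_multipartition l}
     else {\<Lambda> \<in> multipartitions l.
             \<forall>M \<in> multipartitions l. content d M = content d \<Lambda> \<longrightarrow> M = \<Lambda>})"

text \<open>Intersecting inside \<^term>\<open>multipartitions l\<close> yields all multipartitions for the empty set of data.\<close>

definition common_cores :: "nat \<Rightarrow> datum set \<Rightarrow> ptn list set" where
  "common_cores l D = multipartitions l \<inter> (\<Inter>d\<in>D. cores l d)"

text \<open>\<open>Gcd {} = Gcd {0} = 0\<close>, as required by the convention for these two cases.\<close>

definition data_gcd :: "nat \<Rightarrow> datum set \<Rightarrow> int" where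
  "data_gcd l D =
    Gcd ({int (fst d) | d. d \<in> D} \<union>
         {snd d ! i - snd d ! j - snd e ! i + snd e ! j | d e i j.
            d \<in> D \<and> e \<in> D \<and> i < l \<and> j < l})"

definition always_maximal :: "nat \<Rightarrow> datum set \<Rightarrow> nat \<Rightarrow> bool" where
  "always_maximal l D k \<longleftrightarrow> (\<forall>d\<in>D. \<forall>j<l. snd d ! k \<ge> snd d ! j)"

definition sometimes_maximal :: "nat \<Rightarrow> datum set \<Rightarrow> nat \<Rightarrow> bool" where
  "sometimes_maximal l D k \<longleftrightarrow> (\<exists>d\<in>D. \<forall>j<l. snd d ! k \<ge> snd d ! j)"

definition always_minimal :: "nat \<Rightarrow> datum set \<Rightarrow> nat \<Rightarrow> bool" where
  "always_minimal l D k \<longleftrightarrow> (\<forall>d\<in>D. \<forall>j<l. snd d ! k \<le> snd d ! j)"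

definition sometimes_minimal :: "nat \<Rightarrow> datum set \<Rightarrow> nat \<Rightarrow> bool" where
  "sometimes_minimal l D k \<longleftrightarrow> (\<exists>d\<in>D. \<forall>j<l. snd d ! k \<le> snd d ! j)"

definition condition_X :: "nat \<Rightarrow> datum set \<Rightarrow> bool" where
  "condition_X l D \<longleftrightarrow>
    (\<exists>k<l. sometimes_maximal l D k \<and> \<not> always_maximal l D k) \<and>
    (\<exists>k<l. sometimes_minimal l D k \<and> \<not> always_minimal l D k)"

end

theory Submission
  imports Defs "HOL-Library.Infinite_Set" "HOL-Computational_Algebra.Group_Closure"
begin

text \<open>
  Translating the beta-set \<open>{p a - a - 1}\<close> of the \<open>k\<close>-th component by the \<open>k\<close>-th charge turns an
  \<open>l\<close>-multipartition into an \<open>l\<close>-row 0/1 matrix with columns indexed by the integers. The row sums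
  (suitably regularised) are the charges and the column sums encode the \<open>(0 | c)\<close>-content. Such a
  matrix is determined by its row and column sums iff it admits no 2 by 2 switch, i.e. iff its rows
  form a chain under inclusion.

  Comparing the chains for two data shows that for every \<open>h\<close> in the group generated by the
  differences defining \<open>g\<close>, translation by \<open>h\<close> changes a beta-set in a bounded number of places; if
  \<open>g = 1\<close> the beta-sets have boundedly many runs. A component that is sometimes but not always
  maximal, or sometimes but not always minimal, has a beta-set closed under subtracting a fixed
  \<open>D > 0\<close>, which with boundedly many runs leaves finitely many choices. The maximal one bounds all
  other components from above, the minimal one from below.

  Conversely, if every sometimes maximal (minimal) component is always so, put a long row (column) in
  these components. If \<open>g\<close> is not \<open>1\<close>, all data agree modulo some \<open>p \<ge> 2\<close> up to constants, and the
  images of half-lines under permutations of the integers commuting with translation by \<open>p\<close> always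
  form chains.
\<close>

section \<open>Charged sets of integers\<close>

text \<open>Normalised so that \<open>{..<c}\<close> has charge \<open>c\<close>: for all low enough
  \<open>x\<close>, the set has as many elements from \<open>x\<close> on as \<open>{..<c}\<close>.
  This is the regularised row sum of a Maya diagram.\<close>

definition has_charge :: "int \<Rightarrow> int set \<Rightarrow> bool" where
  "has_charge c B \<longleftrightarrow> bdd_above B \<and> (\<exists>X. \<forall>x\<le>X. int (card (B \<inter> {x..})) = c - x)"

definition translate :: "int \<Rightarrow> int set \<Rightarrow> int set" where
  "translate d A = {x. x - d \<in> A}"

lemma translate_translate [simp]: "translate d (translate e A) = translate (d + e) A"
  by (auto simp: translate_def algebra_simps)

lemma translate_0 [simp]: "translate 0 A = A"
  by (simp add: translate_def)

lemma translate_eq_image: "translate d A = (+) d ` A"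
  by (force simp: translate_def)

lemma translate_mono: "A \<subseteq> B \<Longrightarrow> translate d A \<subseteq> translate d B"
  by (auto simp: translate_def)

lemma has_charge_finite:
  assumes "has_charge c B" shows "finite (B \<inter> {x..})"
proof -
  obtain M where "\<forall>y\<in>B. y \<le> M" using assms by (auto simp: has_charge_def bdd_above_def)
  then have "B \<inter> {x..} \<subseteq> {x..M}" by auto
  then show ?thesis by (rule finite_subset) simp
qed

lemma card_atLeast_Suc:
  fixes B :: "int set"
  assumes "finite (B \<inter> {x..})"
  shows "int (card (B \<inter> {x..})) = int (card (B \<inter> {x + 1..})) + of_bool (x \<in> B)"
proof -
  have fin: "finite (B \<inter> {x + 1..})" by (rule finite_subset[OF _ assms]) auto
  show ?thesis
  proof (cases "x \<in> B")
    case True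
    then have "B \<inter> {x..} = insert x (B \<inter> {x + 1..})" by auto
    then show ?thesis using fin True by simp
  next
    case False
    then have "B \<inter> {x..} = B \<inter> {x + 1..}" by (auto simp: le_less)
    then show ?thesis using False by simp
  qed
qed

text \<open>Lowering a low cutoff by one raises the count by exactly one, so the integer just passed
  is in the set.\<close>

lemma has_charge_lower:
  assumes "has_charge c B" obtains X where "{..<X} \<subseteq> B"
proof -
  obtain X where X: "\<forall>x\<le>X. int (card (B \<inter> {x..})) = c - x"
    using assms by (auto simp: has_charge_def)
  have "x \<in> B" if "x < X" for x
    using card_atLeast_Suc[OF has_charge_finite[OF assms], of x] X that
    by (auto split: if_splits simp: of_bool_def)
  then show ?thesis using that[of X] by auto
qed

text \<open>Below a low cutoff \<open>B\<close> already contains everything, so the difference lies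
  above it, where the counts \<open>c - x\<close> and \<open>c' - x\<close> subtract.\<close>

lemma has_charge_Diff:
  assumes "has_charge c B" "has_charge c' B'" "B \<subseteq> B'"
  shows "finite (B' - B)" "int (card (B' - B)) = c' - c"
proof -
  obtain X where X: "\<forall>x\<le>X. int (card (B \<inter> {x..})) = c - x"
    using assms(1) by (auto simp: has_charge_def)
  obtain X' where X': "\<forall>x\<le>X'. int (card (B' \<inter> {x..})) = c' - x"
    using assms(2) by (auto simp: has_charge_def)
  obtain Y where Y: "{..<Y} \<subseteq> B" using has_charge_lower[OF assms(1)] .
  define x where "x = min X (min X' Y)"
  have eq: "B' - B = B' \<inter> {x..} - B \<inter> {x..}" using Y by (force simp: x_def)
  show "finite (B' - B)" unfolding eq using has_charge_finite[OF assms(2)] by blast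
  have "card (B' - B) = card (B' \<inter> {x..}) - card (B \<inter> {x..})" unfolding eq
    using has_charge_finite[OF assms(1)] assms(3) by (intro card_Diff_subset) auto
  moreover have "card (B \<inter> {x..}) \<le> card (B' \<inter> {x..})"
    using has_charge_finite[OF assms(2)] assms(3) by (intro card_mono) auto
  moreover have "int (card (B \<inter> {x..})) = c - x" "int (card (B' \<inter> {x..})) = c' - x"
    using X X' by (simp_all add: x_def)
  ultimately show "int (card (B' - B)) = c' - c" by linarith
qed

text \<open>The difference has \<open>c' - c \<le> 0\<close> elements. Both directions of the core
  criterion rest on this rigidity.\<close>

lemma has_charge_subset_eq:
  assumes "has_charge c B" "has_charge c' B'" "B \<subseteq> B'" "c' \<le> c"
  shows "B = B'"
proof -
  have "card (B' - B) = 0" using has_charge_Diff(2)[OF assms(1-3)] assms(4) by linarith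
  then have "B' - B = {}" using has_charge_Diff(1)[OF assms(1-3)] by (simp only: card_0_eq)
  then show ?thesis using assms(3) by auto
qed

lemma card_translate_Int_atLeast:
  "card (translate d B \<inter> {x..}) = card (B \<inter> {x - d..})"
proof -
  have "translate d B \<inter> {x..} = (+) d ` (B \<inter> {x - d..})"
    by (force simp: translate_eq_image)
  then show ?thesis by (simp add: card_image)
qed

lemma has_charge_translate:
  assumes "has_charge c B" shows "has_charge (c + d) (translate d B)"
proof -
  obtain X where X: "\<forall>x\<le>X. int (card (B \<inter> {x..})) = c - x"
    using assms by (auto simp: has_charge_def)
  then have "\<forall>x\<le>X + d. int (card (translate d B \<inter> {x..})) = c + d - x"
    by (simp add: card_translate_Int_atLeast)
  moreover have "bdd_above (translate d B)"
  proof -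
    obtain M where "\<forall>y\<in>B. y \<le> M" using assms by (auto simp: has_charge_def bdd_above_def)
    then have "\<forall>y\<in>translate d B. y \<le> M + d" by (force simp: translate_def)
    then show ?thesis by (auto simp: bdd_above_def)
  qed
  ultimately show ?thesis unfolding has_charge_def by blast
qed

lemma has_charge_lessThan: "has_charge c {..<c}"
  unfolding has_charge_def
proof (intro conjI exI[of _ c] allI impI)
  fix x assume "x \<le> c"
  moreover have "{..<c} \<inter> {x..} = {x..<c}" by auto
  ultimately show "int (card ({..<c} \<inter> {x..})) = c - x" by simp
qed auto

lemma card_exchange:
  fixes B :: "int set"
  assumes "finite (B \<inter> {z..})" "x \<notin> B" "y \<in> B"
  shows "int (card (insert x (B - {y}) \<inter> {z..})) =
    int (card (B \<inter> {z..})) + of_bool (z \<le> x) - of_bool (z \<le> y)"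
proof -
  have fin: "finite ((B - {y}) \<inter> {z..})" by (rule finite_subset[OF _ assms(1)]) auto
  have "int (card ((B - {y}) \<inter> {z..})) = int (card (B \<inter> {z..})) - of_bool (z \<le> y)"
  proof (cases "z \<le> y")
    case True
    then have "B \<inter> {z..} = insert y ((B - {y}) \<inter> {z..})" using assms(3) by auto
    then show ?thesis using fin True by simp
  next
    case False
    then have "(B - {y}) \<inter> {z..} = B \<inter> {z..}" by auto
    then show ?thesis using False by simp
  qed
  moreover have "int (card (insert x (B - {y}) \<inter> {z..})) =
    int (card ((B - {y}) \<inter> {z..})) + of_bool (z \<le> x)"
    using fin assms(2) by (auto simp: Int_insert_left)
  ultimately show ?thesis by simp
qed

text \<open>A cutoff below both \<open>x\<close> and \<open>y\<close> sees one gain and one loss.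
  This move underlies both the switches and the induction on abaci.\<close>

lemma has_charge_exchange:
  assumes "has_charge c B" "x \<notin> B" "y \<in> B"
  shows "has_charge c (insert x (B - {y}))"
proof -
  obtain X where X: "\<forall>x\<le>X. int (card (B \<inter> {x..})) = c - x"
    using assms by (auto simp: has_charge_def)
  have "int (card (insert x (B - {y}) \<inter> {z..})) = c - z" if "z \<le> min X (min x y)" for z
    using card_exchange[OF has_charge_finite[OF assms(1)] assms(2,3), of z] X that by simp
  moreover have "bdd_above (insert x (B - {y}))"
    using assms(1) by (auto simp: has_charge_def intro: bdd_above_mono)
  ultimately show ?thesis unfolding has_charge_def by blast
qed

section \<open>Beta-sets of partitions\<close>

text \<open>With rows numbered from 0, the offset 1 gives the empty partition the beta-set
  \<open>{..<0}\<close>, of charge 0.\<close>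

definition beta :: "ptn \<Rightarrow> nat \<Rightarrow> int" where
  "beta p a = int (p a) - int a - 1"

definition beta_set :: "ptn \<Rightarrow> int set" where
  "beta_set p = range (beta p)"

lemma beta_strict_antimono:
  assumes "antimono p" "a < b" shows "beta p b < beta p a"
  using antimonoD[OF assms(1), of a b] assms(2) by (simp add: beta_def)

lemma inj_beta: "antimono p \<Longrightarrow> inj (beta p)"
  by (metis beta_strict_antimono injI linorder_neqE_nat order_less_irrefl)

text \<open>A strictly decreasing sequence is recovered from its range: at the first index not yet
  matched, each value occurs in the other sequence at that index or later.\<close>

lemma beta_set_inj:
  assumes "p \<in> partitions" "q \<in> partitions" "beta_set p = beta_set q"
  shows "p = q"
proof
  have le: "beta p a \<le> beta q a"
    if anti: "antimono p" "antimono q" and eq: "beta_set p = beta_set q"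
      and less: "\<And>b. b < a \<Longrightarrow> beta p b = beta q b" for p q a
  proof -
    obtain b where b: "beta p a = beta q b" using eq by (metis beta_set_def rangeE rangeI)
    have "\<not> b < a" using less[of b] b beta_strict_antimono[OF anti(1), of b a] by auto
    then show ?thesis using b beta_strict_antimono[OF anti(2), of a b] by (cases "a = b") auto
  qed
  have "beta p a = beta q a" for a
  proof (induction a rule: less_induct)
    case (less a)
    then show ?case using le[of p q a] le[of q p a] assms by (auto simp: partitions_def)
  qed
  then show "p a = q a" for a by (simp add: beta_def)
qed

lemma card_beta_set:
  assumes "antimono p" shows "card (beta_set p \<inter> {x..}) = card {a. x \<le> beta p a}"
proof -
  have "beta_set p \<inter> {x..} = beta p ` {a. x \<le> beta p a}" by (auto simp: beta_set_def)
  moreover have "inj_on (beta p) {a. x \<le> beta p a}"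
    using inj_beta[OF assms] by (rule inj_on_subset) simp
  ultimately show ?thesis by (simp add: card_image)
qed

lemma has_charge_beta_set:
  assumes "p \<in> partitions" shows "has_charge 0 (beta_set p)"
  unfolding has_charge_def
proof
  have anti: "antimono p" and fin: "finite {a. p a \<noteq> 0}" using assms by (auto simp: partitions_def)
  have "beta p a \<le> int (p 0)" for a using antimonoD[OF anti, of 0 a] by (simp add: beta_def)
  then show "bdd_above (beta_set p)" by (auto simp: bdd_above_def beta_set_def)
  obtain n where n: "\<And>a. n \<le> a \<Longrightarrow> p a = 0"
    using fin by (metis (mono_tags, lifting) mem_Collect_eq finite_nat_set_iff_bounded not_le)
  have "int (card (beta_set p \<inter> {x..})) = 0 - x" if "x \<le> - int n" for x
  proof -
    have "{a. x \<le> beta p a} = {..<nat (- x)}"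
    proof (rule set_eqI)
      fix a show "a \<in> {a. x \<le> beta p a} \<longleftrightarrow> a \<in> {..<nat (- x)}"
        using n[of a] that by (cases "n \<le> a") (auto simp: beta_def)
    qed
    then show ?thesis using that by (simp add: card_beta_set[OF anti])
  qed
  then show "\<exists>X. \<forall>x\<le>X. int (card (beta_set p \<inter> {x..})) = 0 - x" by blast
qed

text \<open>If \<open>b\<close> lists \<open>B\<close> downwards, the parts must be
  \<open>b a + a + 1\<close>; charge 0 makes them eventually 0, and monotonicity then makes them all
  nonnegative.\<close>

lemma beta_set_surj:
  assumes "has_charge 0 B" obtains p where "p \<in> partitions" "beta_set p = B"
proof -
  obtain X where X: "\<forall>x\<le>X. int (card (B \<inter> {x..})) = - x"
    using assms by (auto simp: has_charge_def)
  obtain M where M: "\<forall>y\<in>B. y \<le> M" using assms by (auto simp: has_charge_def bdd_above_def)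
  obtain Y where Y: "{..<Y} \<subseteq> B" using has_charge_lower[OF assms] .
  \<comment> \<open>Reflection in an upper bound turns \<open>B\<close> into a set of naturals,
    whose increasing enumeration lists \<open>B\<close> downwards.\<close>
  define C where "C = (\<lambda>x. nat (M - x)) ` B"
  have "infinite C"
  proof
    have "inj_on (\<lambda>x. nat (M - x)) B"
      by (rule inj_onI) (use M in \<open>auto simp: nat_eq_iff split: if_splits\<close>)
    moreover assume "finite C"
    ultimately have "finite B" by (simp add: C_def finite_image_iff)
    then show False using finite_subset[OF Y] infinite_Iio by blast
  qed
  define b where "b a = M - int (Infinite_Set.enumerate C a)" for a
  have b_less: "b a' < b a" if "a < a'" for a a'
    using enumerate_mono[OF that \<open>infinite C\<close>] by (simp add: b_def)
  have range_b: "range b = B"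
  proof -
    have "range b = (\<lambda>n. M - int n) ` range (Infinite_Set.enumerate C)"
      by (simp add: b_def[abs_def] image_image)
    also have "\<dots> = (\<lambda>n. M - int n) ` C"
      by (simp only: range_enumerate[OF \<open>infinite C\<close>])
    also have "\<dots> = (\<lambda>x. M - int (nat (M - x))) ` B"
      by (simp only: C_def image_image)
    also have "\<dots> = (\<lambda>x. x) ` B"
      using M by (intro image_cong) auto
    also have "\<dots> = B" by simp
    finally show ?thesis .
  qed
  define f where "f a = b a + int a + 1" for a
  have f_anti: "f a' \<le> f a" if "a \<le> a'" for a a'
    using that
  proof (induction rule: dec_induct)
    case (step n)
    then show ?case using b_less[of n "Suc n"] by (simp add: f_def)
  qed simp
  \<comment> \<open>Exactly \<open>b 0, ..., b a\<close> lie at or above \<open>b a\<close>; once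
    \<open>b a\<close> is low enough, the charge equates their number \<open>a + 1\<close> with
    \<open>- b a\<close>.\<close>
  have f_0: "f a = 0" if "nat (M - X) \<le> a" for a
  proof -
    have "b a \<le> X" using that le_enumerate[OF \<open>infinite C\<close>, of a] by (simp add: b_def)
    then have "int (card (B \<inter> {b a..})) = - b a" using X by blast
    moreover have "B \<inter> {b a..} = b ` {..a}"
    proof -
      have "b a \<le> b a' \<longleftrightarrow> a' \<le> a" for a'
        using b_less[of a a'] b_less[of a' a] by (cases a a' rule: linorder_cases) auto
      then show ?thesis unfolding range_b[symmetric] by auto
    qed
    moreover have "inj_on b {..a}"
      by (rule inj_onI) (metis b_less linorder_neqE_nat order_less_irrefl)
    ultimately have "int (Suc a) = - b a" by (simp add: card_image)
    then show ?thesis by (simp add: f_def)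
  qed
  have f_nonneg: "0 \<le> f a" for a
    using f_anti[of a "max a (nat (M - X))"] f_0[of "max a (nat (M - X))"] by simp
  define p where "p a = nat (f a)" for a
  have "{a. p a \<noteq> 0} \<subseteq> {..<nat (M - X)}" using f_0 by (force simp: p_def not_less[symmetric])
  then have "finite {a. p a \<noteq> 0}" by (rule finite_subset) simp
  moreover have "antimono p" unfolding p_def by (intro antimonoI nat_mono f_anti)
  ultimately have "p \<in> partitions" by (simp add: partitions_def)
  moreover have "beta p = b" using f_nonneg by (auto simp: beta_def p_def f_def)
  ultimately show ?thesis using that range_b by (simp add: beta_set_def)
qed

section \<open>Cores as chains of beta-sets\<close>

definition charged_beta_set :: "int list \<Rightarrow> ptn list \<Rightarrow> nat \<Rightarrow> int set" where
  "charged_beta_set c \<Lambda> k = translate (c ! k) (beta_set (\<Lambda> ! k))"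

lemma multipartitions_nth: "\<Lambda> \<in> multipartitions l \<Longrightarrow> k < l \<Longrightarrow> \<Lambda> ! k \<in> partitions"
  by (auto simp: multipartitions_def)

lemma has_charge_charged_beta_set:
  assumes "\<Lambda> \<in> multipartitions l" "k < l"
  shows "has_charge (c ! k) (charged_beta_set c \<Lambda> k)"
  using has_charge_translate[OF has_charge_beta_set[OF multipartitions_nth[OF assms]], of "c ! k"]
  by (simp add: charged_beta_set_def)

lemma charged_beta_set_inj:
  assumes "\<Lambda> \<in> multipartitions l" "M \<in> multipartitions l" "k < l"
    "charged_beta_set c \<Lambda> k = charged_beta_set c M k"
  shows "\<Lambda> ! k = M ! k"
proof -
  have "beta_set (\<Lambda> ! k) = beta_set (M ! k)"
    using arg_cong[OF assms(4), of "translate (- (c ! k))"] by (simp add: charged_beta_set_def)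
  then show ?thesis
    by (rule beta_set_inj[OF multipartitions_nth[OF assms(1,3)] multipartitions_nth[OF assms(2,3)]])
qed

text \<open>Row \<open>a\<close> of component \<open>k\<close> has at most one node of residue
  \<open>r\<close>, in column \<open>r - c ! k + a\<close>. \<open>S k\<close> collects the rows
  having it; the \<open>max\<close> term removes the rows where that column would be
  negative.\<close>

lemma count_content:
  assumes "\<Lambda> \<in> multipartitions l"
  shows "int (count (content (0, c) \<Lambda>) r) =
    (\<Sum>k<l. int (card (charged_beta_set c \<Lambda> k \<inter> {r..})) - max 0 (c ! k - r))"
proof -
  define S where "S k = {a. c ! k - r \<le> int a \<and> r - c ! k \<le> beta (\<Lambda> ! k) a}" for k
  have S: "finite (S k) \<and> int (card (S k)) =
    int (card (charged_beta_set c \<Lambda> k \<inter> {r..})) - max 0 (c ! k - r)" if "k < l" for k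
  proof -
    define x where "x = r - c ! k"
    define p where "p = \<Lambda> ! k"
    have p: "p \<in> partitions" using multipartitions_nth[OF assms that] by (simp add: p_def)
    then have anti: "antimono p" by (simp add: partitions_def)
    define U where "U = {a. x \<le> beta p a}"
    have "beta p ` U = beta_set p \<inter> {x..}" by (auto simp: U_def beta_set_def)
    then have "finite (beta p ` U)" using has_charge_finite[OF has_charge_beta_set[OF p]] by simp
    then have finU: "finite U"
      using inj_beta[OF anti] by (metis finite_imageD inj_on_subset subset_UNIV)
    have sub: "{..<nat (- x)} \<subseteq> U" by (auto simp: U_def beta_def)
    have eq: "S k = U - {..<nat (- x)}" by (auto simp: S_def U_def x_def p_def)
    have "card (S k) = card U - nat (- x)" "nat (- x) \<le> card U"
      unfolding eq using card_Diff_subset[OF _ sub] card_mono[OF finU sub] by simp_all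
    moreover have "card U = card (charged_beta_set c \<Lambda> k \<inter> {r..})"
      using card_beta_set[OF anti, of x]
      by (simp add: charged_beta_set_def card_translate_Int_atLeast U_def x_def p_def)
    ultimately show ?thesis using finU by (simp add: eq x_def)
  qed
  have fin: "finite (nodes \<Lambda>)" by (rule finite_nodes[OF assms])
  have len: "length \<Lambda> = l" using assms by (simp add: multipartitions_def)
  have "count (content (0, c) \<Lambda>) r = card {x \<in> nodes \<Lambda>. residue (0, c) x = r}"
    using fin by (simp add: content_def count_image_mset vimage_def Collect_conj_eq Int_commute)
  also have "{x \<in> nodes \<Lambda>. residue (0, c) x = r} =
    (\<lambda>(k, a). (a, nat (r - c ! k + int a), k)) ` (SIGMA k:{..<l}. S k)"
  proof (intro equalityI subsetI)
    fix x assume "x \<in> {x \<in> nodes \<Lambda>. residue (0, c) x = r}"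
    then obtain a b k where "x = (a, b, k)" "k < l" "b < (\<Lambda> ! k) a" "int b - int a + c ! k = r"
      using len by (auto simp: nodes_def)
    then show "x \<in> (\<lambda>(k, a). (a, nat (r - c ! k + int a), k)) ` (SIGMA k:{..<l}. S k)"
      by (intro image_eqI[of _ _ "(k, a)"]) (auto simp: S_def beta_def)
  qed (auto simp: nodes_def S_def beta_def len)
  also have "card \<dots> = card (SIGMA k:{..<l}. S k)"
    by (rule card_image) (auto simp: inj_on_def)
  also have "int \<dots> = (\<Sum>k<l. int (card (S k)))"
    using S by simp
  also have "\<dots> = (\<Sum>k<l. int (card (charged_beta_set c \<Lambda> k \<inter> {r..})) - max 0 (c ! k - r))"
    using S by (intro sum.cong) auto
  finally show ?thesis .
qed

text \<open>The \<open>max\<close> correction depends only on \<open>c\<close> and \<open>r\<close>,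
  so it cancels.\<close>

lemma content_eq_iff:
  assumes "\<Lambda> \<in> multipartitions l" "M \<in> multipartitions l"
  shows "content (0, c) M = content (0, c) \<Lambda> \<longleftrightarrow>
    (\<forall>r. (\<Sum>k<l. int (card (charged_beta_set c M k \<inter> {r..}))) =
         (\<Sum>k<l. int (card (charged_beta_set c \<Lambda> k \<inter> {r..}))))"
proof -
  have "content (0, c) M = content (0, c) \<Lambda> \<longleftrightarrow>
    (\<forall>r. int (count (content (0, c) M) r) = int (count (content (0, c) \<Lambda>) r))"
    by (simp add: multiset_eq_iff)
  then show ?thesis unfolding count_content[OF assms(1)] count_content[OF assms(2)] sum_subtractf
    by simp
qed

text \<open>Equal charges give inclusions both ways, so the two sets then coincide.\<close>

definition chained :: "nat \<Rightarrow> int list \<Rightarrow> ptn list \<Rightarrow> bool" where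
  "chained l c \<Lambda> \<longleftrightarrow> (\<forall>i<l. \<forall>j<l. c ! j \<le> c ! i \<longrightarrow>
    charged_beta_set c \<Lambda> j \<subseteq> charged_beta_set c \<Lambda> i)"

lemma chainedD:
  "chained l c \<Lambda> \<Longrightarrow> i < l \<Longrightarrow> j < l \<Longrightarrow> c ! j \<le> c ! i \<Longrightarrow> x \<in> charged_beta_set c \<Lambda> j \<Longrightarrow>
    x \<in> charged_beta_set c \<Lambda> i"
  unfolding chained_def by blast

lemma finite_argmax:
  fixes f :: "'a \<Rightarrow> 'b::linorder"
  assumes "finite D" "D \<noteq> {}"
  obtains k where "k \<in> D" "\<And>j. j \<in> D \<Longrightarrow> f j \<le> f k"
proof -
  have "Max (f ` D) \<in> f ` D" using assms by (intro Max_in) auto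
  then obtain k where "k \<in> D" "Max (f ` D) = f k" by blast
  moreover have "f j \<le> Max (f ` D)" if "j \<in> D" for j using assms that by simp
  ultimately show ?thesis using that by simp
qed

text \<open>A failed inclusion yields \<open>x\<close> in row \<open>j\<close> only. As the charge
  of row \<open>i\<close> is no smaller, row \<open>i\<close> is not contained in row
  \<open>j\<close> either, which yields \<open>y\<close>. Swapping them gives another multipartition
  of the same content.\<close>

lemma core_imp_chained:
  assumes "\<Lambda> \<in> cores l (0, c)"
  shows "chained l c \<Lambda>"
  unfolding chained_def
proof (intro allI impI, rule ccontr)
  fix i j assume ij: "i < l" "j < l" "c ! j \<le> c ! i"
  let ?B = "charged_beta_set c \<Lambda>"
  have mp: "\<Lambda> \<in> multipartitions l"
    and uniq: "\<And>M. M \<in> multipartitions l \<Longrightarrow> content (0, c) M = content (0, c) \<Lambda> \<Longrightarrow> M = \<Lambda>"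
    using assms by (auto simp: cores_def)
  note charge = has_charge_charged_beta_set[OF mp, of _ c]
  assume "\<not> ?B j \<subseteq> ?B i"
  then obtain x where x: "x \<in> ?B j" "x \<notin> ?B i" by blast
  have "\<not> ?B i \<subseteq> ?B j"
    using has_charge_subset_eq[OF charge charge, OF ij(1,2)] ij(3) x by blast
  then obtain y where y: "y \<in> ?B i" "y \<notin> ?B j" by blast
  have neq: "i \<noteq> j" using x by auto
  define B' where "B' k = (if k = i then insert x (?B i - {y})
    else if k = j then insert y (?B j - {x}) else ?B k)" for k
  have "has_charge (c ! k) (B' k)" if "k < l" for k
    using has_charge_exchange[OF charge] ij(1,2) that x y by (simp add: B'_def charge)
  then have "has_charge 0 (translate (- (c ! k)) (B' k))" if "k < l" for k
    using has_charge_translate[of "c ! k" _ "- (c ! k)"] that by simp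
  then have "\<forall>k. \<exists>p. k < l \<longrightarrow> p \<in> partitions \<and> beta_set p = translate (- (c ! k)) (B' k)"
    using beta_set_surj by metis
  then obtain p where p: "\<And>k. k < l \<Longrightarrow> p k \<in> partitions"
    "\<And>k. k < l \<Longrightarrow> beta_set (p k) = translate (- (c ! k)) (B' k)" by metis
  define M where "M = map p [0..<l]"
  have M: "M \<in> multipartitions l" using p by (auto simp: multipartitions_def M_def)
  have BM: "charged_beta_set c M k = B' k" if "k < l" for k
    using p that by (simp add: charged_beta_set_def M_def)
  have "(\<Sum>k<l. int (card (charged_beta_set c M k \<inter> {r..}))) =
    (\<Sum>k<l. int (card (?B k \<inter> {r..})))" for r
  proof -
    \<comment> \<open>\<open>e\<close> is the change in the tail count of row \<open>i\<close>; row
      \<open>j\<close> changes by \<open>- e\<close>.\<close>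
    define e where "e = of_bool (r \<le> x) - (of_bool (r \<le> y) :: int)"
    have "int (card (B' k \<inter> {r..})) = int (card (?B k \<inter> {r..})) +
      ((if k = i then e else 0) - (if k = j then e else 0))" if "k < l" for k
      using card_exchange[OF has_charge_finite[OF charge[OF ij(1)]] x(2) y(1), of r]
        card_exchange[OF has_charge_finite[OF charge[OF ij(2)]] y(2) x(1), of r] neq
      by (simp add: B'_def e_def)
    then show ?thesis using ij(1,2) by (simp add: BM sum.distrib sum_subtractf)
  qed
  then have "M = \<Lambda>" using uniq M content_eq_iff[OF mp M] by blast
  then show False using BM[OF ij(1)] x by (auto simp: B'_def)
qed

text \<open>Among the components where \<open>M\<close> and \<open>\<Lambda>\<close> differ, take
  one of largest charge. A column met by \<open>M\<close> there is met by some differing row of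
  \<open>\<Lambda>\<close>, hence by its largest one; equal charges then make the two rows
  equal.\<close>

lemma chained_imp_core:
  assumes "\<Lambda> \<in> multipartitions l" "chained l c \<Lambda>"
  shows "\<Lambda> \<in> cores l (0, c)"
proof -
  let ?B = "charged_beta_set c"
  have "M = \<Lambda>" if M: "M \<in> multipartitions l" and cont: "content (0, c) M = content (0, c) \<Lambda>" for M
  proof (rule ccontr)
    assume "M \<noteq> \<Lambda>"
    define D where "D = {k. k < l \<and> M ! k \<noteq> \<Lambda> ! k}"
    have "D \<noteq> {}" using \<open>M \<noteq> \<Lambda>\<close> M assms(1)
      by (auto simp: D_def multipartitions_def list_eq_iff_nth_eq)
    have "finite D" by (simp add: D_def)
    obtain k where k: "k \<in> D" and kmax: "\<And>j. j \<in> D \<Longrightarrow> c ! j \<le> c ! k"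
      using finite_argmax[OF \<open>finite D\<close> \<open>D \<noteq> {}\<close>, of "(!) c"] by blast
    \<comment> \<open>Membership is a difference of consecutive tail counts, so equal contents give
      equal column sums.\<close>
    have split: "(\<Sum>k<l. of_bool (x \<in> ?B N k) :: int) =
      (\<Sum>k<l. int (card (?B N k \<inter> {x..}))) - (\<Sum>k<l. int (card (?B N k \<inter> {x + 1..})))"
      if "N \<in> multipartitions l" for x N
      unfolding sum_subtractf[symmetric]
    proof (rule sum.cong)
      fix k assume "k \<in> {..<l}"
      then show "of_bool (x \<in> ?B N k) =
        int (card (?B N k \<inter> {x..})) - int (card (?B N k \<inter> {x + 1..}))"
        using card_atLeast_Suc[OF has_charge_finite[OF has_charge_charged_beta_set[OF that]], of k _ x]
        by simp
    qed simp
    have cols: "(\<Sum>k<l. of_bool (x \<in> ?B M k)) = (\<Sum>k<l. of_bool (x \<in> ?B \<Lambda> k) :: int)" for x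
      using cont unfolding content_eq_iff[OF assms(1) M] split[OF M] split[OF assms(1)] by simp
    have restr: "(\<Sum>k<l. f k) = (\<Sum>k\<in>D. f k) + (\<Sum>k\<in>{..<l} - D. f k)" for f :: "nat \<Rightarrow> int"
      by (subst sum.subset_diff[of D]) (auto simp: D_def)
    have "(\<Sum>k\<in>{..<l} - D. of_bool (x \<in> ?B M k)) = (\<Sum>k\<in>{..<l} - D. of_bool (x \<in> ?B \<Lambda> k) :: int)" for x
      by (intro sum.cong) (auto simp: D_def charged_beta_set_def)
    then have colsD: "(\<Sum>k\<in>D. of_bool (x \<in> ?B M k)) = (\<Sum>k\<in>D. of_bool (x \<in> ?B \<Lambda> k) :: int)" for x
      using cols[of x] unfolding restr by simp
    have "?B M k \<subseteq> ?B \<Lambda> k"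
    proof
      fix x assume x: "x \<in> ?B M k"
      have "\<exists>j\<in>D. x \<in> ?B \<Lambda> j"
      proof (rule ccontr)
        assume "\<not> (\<exists>j\<in>D. x \<in> ?B \<Lambda> j)"
        then have "(\<Sum>k\<in>D. of_bool (x \<in> ?B M k) :: int) = 0" using colsD[of x] by simp
        then show False using x k \<open>finite D\<close> by (auto simp: sum_nonneg_eq_0_iff)
      qed
      then show "x \<in> ?B \<Lambda> k" using assms(2) kmax k by (auto simp: D_def chained_def)
    qed
    moreover have "k < l" using k by (simp add: D_def)
    ultimately have "?B M k = ?B \<Lambda> k"
      using has_charge_subset_eq[OF has_charge_charged_beta_set[OF M]
          has_charge_charged_beta_set[OF assms(1)]] by blast
    then show False using charged_beta_set_inj[OF M assms(1)] k by (auto simp: D_def)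
  qed
  then show ?thesis using assms(1) by (simp add: cores_def)
qed

lemma common_cores_eq:
  "common_cores l ((\<lambda>t. (0, c t)) ` T) =
    {\<Lambda> \<in> multipartitions l. \<forall>t\<in>T. chained l (c t) \<Lambda>}"
  using core_imp_chained chained_imp_core by (auto simp: common_cores_def)

section \<open>Boundedness of common cores\<close>

text \<open>Equality up to \<open>N\<close> places. Finiteness is explicit because
  \<open>card\<close> of an infinite set is 0.\<close>

definition near :: "nat \<Rightarrow> int set \<Rightarrow> int set \<Rightarrow> bool" where
  "near N A B \<longleftrightarrow> finite (sym_diff A B) \<and> card (sym_diff A B) \<le> N"

lemma near_sym: "near N A B \<Longrightarrow> near N B A"
  by (simp add: near_def Un_commute)

lemma near_trans:
  assumes "near N A B" "near M B C" shows "near (N + M) A C"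
proof -
  have sub: "sym_diff A C \<subseteq> sym_diff A B \<union> sym_diff B C" by blast
  have "card (sym_diff A C) \<le> card (sym_diff A B \<union> sym_diff B C)"
    using assms sub by (intro card_mono) (auto simp: near_def)
  also have "\<dots> \<le> card (sym_diff A B) + card (sym_diff B C)" by (rule card_Un_le)
  finally show ?thesis using assms finite_subset[OF sub] by (auto simp: near_def)
qed

lemma near_translate:
  assumes "near N A B" shows "near N (translate d A) (translate d B)"
proof -
  have "sym_diff (translate d A) (translate d B) = (+) d ` sym_diff A B"
    by (force simp: translate_eq_image)
  then show ?thesis using assms by (simp add: near_def card_image del: image_Un)
qed

lemma near_subset:
  assumes "has_charge c A" "has_charge c' B" "A \<subseteq> B"
  shows "near (nat (c' - c)) A B"
proof -
  have "sym_diff A B = B - A" using assms(3) by blast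
  then show ?thesis using has_charge_Diff[OF assms] by (simp add: near_def)
qed

text \<open>The two rows are nested and their charges differ by the stated bound; translation by
  \<open>- (c ! i)\<close> then removes the charge of \<open>i\<close>.\<close>

lemma chained_near:
  assumes "\<Lambda> \<in> multipartitions l" "chained l c \<Lambda>" "i < l" "j < l"
  shows "near (nat \<bar>c ! i - c ! j\<bar>) (beta_set (\<Lambda> ! i)) (translate (c ! j - c ! i) (beta_set (\<Lambda> ! j)))"
proof -
  note charge = has_charge_charged_beta_set[OF assms(1)]
  have "near (nat \<bar>c ! i - c ! j\<bar>) (charged_beta_set c \<Lambda> i) (charged_beta_set c \<Lambda> j)"
  proof (cases "c ! j \<le> c ! i")
    case True
    then have "charged_beta_set c \<Lambda> j \<subseteq> charged_beta_set c \<Lambda> i"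
      using assms by (auto simp: chained_def)
    from near_sym[OF near_subset[OF charge[OF assms(4)] charge[OF assms(3)] this]] True
    show ?thesis by simp
  next
    case False
    then have "charged_beta_set c \<Lambda> i \<subseteq> charged_beta_set c \<Lambda> j"
      using assms by (auto simp: chained_def)
    from near_subset[OF charge[OF assms(3)] charge[OF assms(4)] this] False
    show ?thesis by simp
  qed
  from near_translate[OF this, of "- (c ! i)"] show ?thesis by (simp add: charged_beta_set_def)
qed

text \<open>Passing from \<open>j\<close> to \<open>i\<close> along \<open>c\<close> and back along
  \<open>e\<close> moves component \<open>j\<close> by a generator of the group; going from
  \<open>k\<close> to \<open>j\<close> and back transfers this to any \<open>k\<close>. The bound
  involves the charges only, not \<open>\<Lambda>\<close>.\<close>

lemma chained_near_translate:
  assumes "\<Lambda> \<in> multipartitions l" "chained l c \<Lambda>" "chained l e \<Lambda>" "i < l" "j < l" "k < l"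
  shows "near (nat \<bar>c ! k - c ! j\<bar> + (nat \<bar>c ! j - c ! i\<bar> + nat \<bar>e ! i - e ! j\<bar>) + nat \<bar>c ! j - c ! k\<bar>)
    (beta_set (\<Lambda> ! k)) (translate (c ! i - c ! j - e ! i + e ! j) (beta_set (\<Lambda> ! k)))"
proof -
  note nc = chained_near[OF assms(1,2)] and ne = chained_near[OF assms(1,3)]
  let ?h = "c ! i - c ! j - e ! i + e ! j"
  have j: "near (nat \<bar>c ! j - c ! i\<bar> + nat \<bar>e ! i - e ! j\<bar>)
    (beta_set (\<Lambda> ! j)) (translate ?h (beta_set (\<Lambda> ! j)))"
    using near_trans[OF nc[OF assms(5,4)] near_translate[OF ne[OF assms(4,5)]]]
    by (simp add: algebra_simps)
  have "near (nat \<bar>c ! k - c ! j\<bar> + (nat \<bar>c ! j - c ! i\<bar> + nat \<bar>e ! i - e ! j\<bar>))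
    (beta_set (\<Lambda> ! k)) (translate (c ! j - c ! k + ?h) (beta_set (\<Lambda> ! j)))"
    using near_trans[OF nc[OF assms(6,5)] near_translate[OF j]] by simp
  from near_trans[OF this near_translate[OF nc[OF assms(5,6)]]] show ?thesis
    by (simp add: algebra_simps)
qed

section \<open>Periodic sets with few runs\<close>

lemma boundary_between:
  fixes u z :: int
  assumes "u < z" "u \<notin> A" "z \<in> A"
  shows "\<exists>x. u < x \<and> x \<le> z \<and> x \<in> A \<and> x - 1 \<notin> A"
  using assms(1,3)
proof (induction z rule: int_gr_induct)
  case base
  then show ?case using assms(2) by (intro exI[of _ "u + 1"]) auto
next
  case (step z)
  show ?case
  proof (cases "z \<in> A")
    case True
    then show ?thesis using step.IH by force
  next
    case False
    then show ?thesis using step by (intro exI[of _ "z + 1"]) auto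
  qed
qed

text \<open>
  Between a gap \<open>m\<close> of \<open>A\<close> and an element \<open>a\<close> above it, each window of length \<open>D\<close> meets both \<open>A\<close>
  and its complement, hence contains an element of \<open>A\<close> whose predecessor is not in \<open>A\<close>.
\<close>

lemma near_periodic_bound:
  assumes "near N A (translate 1 A)" "0 < D" and period: "\<And>x. x \<in> A \<Longrightarrow> x - D \<in> A"
    and "a \<in> A" "m \<notin> A"
  shows "a - m \<le> D * (int N + 1)"
proof (rule ccontr)
  assume large: "\<not> a - m \<le> D * (int N + 1)"
  have periods: "x - D * int q \<in> A" if "x \<in> A" for x q
  proof (induction q)
    case (Suc q)
    from period[OF this] show ?case by (simp add: algebra_simps)
  qed (use that in simp)
  have "\<exists>x. m + D * int q < x \<and> x \<le> m + D * int (Suc q) \<and> x \<in> A \<and> x - 1 \<notin> A" if "q \<le> N" for q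
  proof -
    define u where "u = m + D * int q"
    have "u \<notin> A" using periods[of u q] \<open>m \<notin> A\<close> by (auto simp: u_def)
    have "D * int q \<le> D * (int N + 1)" using that \<open>0 < D\<close> by (intro mult_left_mono) auto
    then have "0 \<le> a - (u + 1)" using large by (simp add: u_def)
    \<comment> \<open>\<open>z\<close> is the point congruent to \<open>a\<close> modulo
      \<open>D\<close> among \<open>u + 1, ..., u + D\<close>, so descending from \<open>a\<close>
      by periods reaches it.\<close>
    define z where "z = u + 1 + (a - (u + 1)) mod D"
    have "0 \<le> (a - (u + 1)) div D"
      using \<open>0 \<le> a - (u + 1)\<close> \<open>0 < D\<close> by (simp add: pos_imp_zdiv_nonneg_iff)
    then have "z = a - D * int (nat ((a - (u + 1)) div D))"
      by (simp add: z_def minus_mult_div_eq_mod[symmetric])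
    then have "z \<in> A" using periods[OF \<open>a \<in> A\<close>] by metis
    moreover have "u < z" "z \<le> u + D"
      using pos_mod_bound[OF \<open>0 < D\<close>, of "a - (u + 1)"] pos_mod_sign[OF \<open>0 < D\<close>, of "a - (u + 1)"]
      by (auto simp: z_def)
    ultimately obtain x where "u < x" "x \<le> z" "x \<in> A" "x - 1 \<notin> A"
      using boundary_between[of u z A] \<open>u \<notin> A\<close> by blast
    then show ?thesis using \<open>z \<le> u + D\<close> by (intro exI[of _ x]) (auto simp: u_def algebra_simps)
  qed
  then obtain X where X: "\<And>q. q \<le> N \<Longrightarrow> m + D * int q < X q"
    "\<And>q. q \<le> N \<Longrightarrow> X q \<le> m + D * int (Suc q)"
    "\<And>q. q \<le> N \<Longrightarrow> X q \<in> A" "\<And>q. q \<le> N \<Longrightarrow> X q - 1 \<notin> A"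
    by metis
  have less: "X q < X q'" if "q < q'" "q' \<le> N" for q q'
  proof -
    have "D * int (Suc q) \<le> D * int q'" using that \<open>0 < D\<close> by (intro mult_left_mono) auto
    then show ?thesis using X(1)[of q'] X(2)[of q] that by linarith
  qed
  have "inj_on X {..N}"
    by (rule inj_onI) (metis less atMost_iff linorder_neqE_nat order_less_irrefl)
  then have "N + 1 = card (X ` {..N})" by (simp add: card_image)
  \<comment> \<open>The chosen points lie in \<open>A\<close> but not in
    \<open>translate 1 A\<close>.\<close>
  also have "\<dots> \<le> card (sym_diff A (translate 1 A))"
    using assms(1) X(3,4) by (intro card_mono) (auto simp: near_def translate_def)
  also have "\<dots> \<le> N" using assms(1) by (simp add: near_def)
  finally show False by simp
qed

text \<open>Unless \<open>A = {..<0}\<close>, charge 0 forces a gap \<open>m\<close> below 0 and an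
  element \<open>a\<close> from 0 on; every element is compared with \<open>m\<close> and every gap
  with \<open>a\<close>.\<close>

lemma has_charge_0_bounds:
  assumes "has_charge 0 A" "0 \<le> K" "\<And>a m. a \<in> A \<Longrightarrow> m \<notin> A \<Longrightarrow> a - m \<le> K"
  shows "A \<subseteq> {..<K}" "{..< - K} \<subseteq> A"
proof -
  have "A \<subseteq> {..<K} \<and> {..< - K} \<subseteq> A"
  proof (cases "A = {..<0}")
    case True
    then show ?thesis using assms(2) by auto
  next
    case False
    have "\<not> {..<0} \<subseteq> A" "\<not> A \<subseteq> {..<0}"
      using False has_charge_subset_eq[OF has_charge_lessThan assms(1)]
        has_charge_subset_eq[OF assms(1) has_charge_lessThan] by auto
    then obtain m a where ma: "m < 0" "m \<notin> A" "0 \<le> a" "a \<in> A" by (meson lessThan_iff not_less subsetI)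
    have "x < K" if "x \<in> A" for x using assms(3)[OF that ma(2)] ma(1) by simp
    moreover have "x \<in> A" if "x < - K" for x using assms(3)[OF ma(4), of x] ma(3) that by force
    ultimately show ?thesis by auto
  qed
  then show "A \<subseteq> {..<K}" "{..< - K} \<subseteq> A" by auto
qed

text \<open>The inclusion for \<open>e\<close> leads from \<open>k\<close> to \<open>j\<close> and
  the one for \<open>c\<close> leads back; the mismatch of the translations is the period.\<close>

lemma chained_periodic:
  assumes "chained l c \<Lambda>" "chained l e \<Lambda>" "j < l" "k < l" "c ! j \<le> c ! k" "e ! k \<le> e ! j"
    and "x \<in> beta_set (\<Lambda> ! k)"
  shows "x - (c ! k - c ! j + (e ! j - e ! k)) \<in> beta_set (\<Lambda> ! k)"
proof -
  have "x + e ! k \<in> charged_beta_set e \<Lambda> k" using assms(7) by (simp add: charged_beta_set_def translate_def)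
  then have "x + e ! k \<in> charged_beta_set e \<Lambda> j" by (rule chainedD[OF assms(2,3,4,6)])
  then have "x + e ! k - e ! j + c ! j \<in> charged_beta_set c \<Lambda> j"
    by (simp add: charged_beta_set_def translate_def)
  then have "x + e ! k - e ! j + c ! j \<in> charged_beta_set c \<Lambda> k" by (rule chainedD[OF assms(1,4,3,5)])
  then show ?thesis by (simp add: charged_beta_set_def translate_def algebra_simps)
qed

lemma finite_partitions_between:
  "finite {p \<in> partitions. {..<a} \<subseteq> beta_set p \<and> beta_set p \<subseteq> {..<b}}" (is "finite ?P")
proof -
  have "beta_set p \<in> (\<union>) {..<a} ` Pow {a..<b}" if "p \<in> ?P" for p
    using that by (intro image_eqI[of _ _ "beta_set p - {..<a}"]) auto
  then have "beta_set ` ?P \<subseteq> (\<union>) {..<a} ` Pow {a..<b}" by blast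
  then have "finite (beta_set ` ?P)" by (rule finite_subset) simp
  moreover have "inj_on beta_set ?P" by (auto intro: inj_onI beta_set_inj)
  ultimately show ?thesis by (rule finite_imageD)
qed

lemma data_gcd_eq:
  "data_gcd l ((\<lambda>t. (0, c t)) ` T) =
    Gcd {c t ! i - c t ! j - c u ! i + c u ! j | t u i j. t \<in> T \<and> u \<in> T \<and> i < l \<and> j < l}"
    (is "_ = Gcd ?S")
proof -
  have "{int (fst d) | d. d \<in> (\<lambda>t. (0, c t)) ` T} = (if T = {} then {} else {0})" by force
  moreover have "{snd d ! i - snd d ! j - snd e ! i + snd e ! j | d e i j.
      d \<in> (\<lambda>t. (0 :: nat, c t)) ` T \<and> e \<in> (\<lambda>t. (0 :: nat, c t)) ` T \<and> i < l \<and> j < l} = ?S" (is "?L = _")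
  proof
    show "?L \<subseteq> ?S" by clarsimp blast
    show "?S \<subseteq> ?L"
    proof
      fix x assume "x \<in> ?S"
      then obtain t u i j where "x = c t ! i - c t ! j - c u ! i + c u ! j"
        "t \<in> T" "u \<in> T" "i < l" "j < l" by blast
      then show "x \<in> ?L"
        by (intro CollectI exI[of _ "(0, c t)"] exI[of _ "(0, c u)"] exI[of _ i] exI[of _ j]) simp
    qed
  qed
  ultimately show ?thesis by (simp add: data_gcd_def)
qed

lemma finite_common_cores:
  fixes T :: "'t set" and c :: "'t \<Rightarrow> int list"
  assumes gcd: "data_gcd l ((\<lambda>t. (0, c t)) ` T) = 1"
    and X: "condition_X l ((\<lambda>t. (0, c t)) ` T)"
  shows "finite {\<Lambda> \<in> multipartitions l. \<forall>t\<in>T. chained l (c t) \<Lambda>}" (is "finite ?C")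
proof -
  define S where "S = {c t ! i - c t ! j - c u ! i + c u ! j | t u i j. t \<in> T \<and> u \<in> T \<and> i < l \<and> j < l}"
  \<comment> \<open>\<open>N\<close> is chosen before \<open>\<Lambda>\<close>: the bound must be
    uniform over all common cores. Generators come from pairs of data, and differences compose two
    approximate translations.\<close>
  have shift: "\<exists>N. \<forall>\<Lambda>\<in>?C. near N (beta_set (\<Lambda> ! k)) (translate h (beta_set (\<Lambda> ! k)))"
    if "k < l" "h \<in> group_closure S" for k h
    using that(2)
  proof induction
    case (base s)
    show ?case
    proof (cases "s = 0")
      case True
      then show ?thesis by (auto simp: near_def)
    next
      case False
      then obtain t u i j where *: "t \<in> T" "u \<in> T" "i < l" "j < l"
        and s: "s = c t ! i - c t ! j - c u ! i + c u ! j" using base unfolding S_def by blast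
      show ?thesis unfolding s
        by (intro exI ballI, rule chained_near_translate) (use * \<open>k < l\<close> in auto)
    qed
  next
    case (diff s s')
    then obtain N N' where
      N: "\<And>\<Lambda>. \<Lambda> \<in> ?C \<Longrightarrow> near N (beta_set (\<Lambda> ! k)) (translate s (beta_set (\<Lambda> ! k)))" and
      N': "\<And>\<Lambda>. \<Lambda> \<in> ?C \<Longrightarrow> near N' (beta_set (\<Lambda> ! k)) (translate s' (beta_set (\<Lambda> ! k)))" by blast
    have "near (N + N') (beta_set (\<Lambda> ! k)) (translate (s - s') (beta_set (\<Lambda> ! k)))"
      if "\<Lambda> \<in> ?C" for \<Lambda>
      using near_trans[OF N[OF that] near_sym[OF near_translate[OF N'[OF that], of "s - s'", simplified]]] by simp
    then show ?case by blast
  qed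
  have "Gcd S = 1" using gcd by (simp add: data_gcd_eq S_def)
  then have one: "1 \<in> group_closure S" using Gcd_in_group_closure[of S] by simp
  \<comment> \<open>The data \<open>t\<close> and \<open>u\<close> order \<open>j\<close> and
    \<open>k\<close> in opposite ways, at least once strictly, so the period \<open>D\<close> is
    positive.\<close>
  have bounded: "\<exists>K. \<forall>\<Lambda>\<in>?C. beta_set (\<Lambda> ! k) \<subseteq> {..<K} \<and> {..< - K} \<subseteq> beta_set (\<Lambda> ! k)"
    if "t \<in> T" "u \<in> T" "j < l" "k < l" "c t ! j \<le> c t ! k" "c u ! k \<le> c u ! j"
      "c t ! j < c t ! k \<or> c u ! k < c u ! j" for t u j k
  proof -
    define D where "D = c t ! k - c t ! j + (c u ! j - c u ! k)"
    have "0 < D" using that by (auto simp: D_def)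
    obtain N where N: "\<And>\<Lambda>. \<Lambda> \<in> ?C \<Longrightarrow> near N (beta_set (\<Lambda> ! k)) (translate 1 (beta_set (\<Lambda> ! k)))"
      using shift[OF \<open>k < l\<close> one] by blast
    have "beta_set (\<Lambda> ! k) \<subseteq> {..<D * (int N + 1)} \<and> {..< - (D * (int N + 1))} \<subseteq> beta_set (\<Lambda> ! k)"
      if \<Lambda>: "\<Lambda> \<in> ?C" for \<Lambda>
    proof -
      have period: "x - D \<in> beta_set (\<Lambda> ! k)" if "x \<in> beta_set (\<Lambda> ! k)" for x
        unfolding D_def using \<Lambda> \<open>t \<in> T\<close> \<open>u \<in> T\<close>
        by (intro chained_periodic[OF _ _ \<open>j < l\<close> \<open>k < l\<close> \<open>c t ! j \<le> c t ! k\<close> \<open>c u ! k \<le> c u ! j\<close> that]) auto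
      have charge: "has_charge 0 (beta_set (\<Lambda> ! k))"
        using \<Lambda> \<open>k < l\<close> has_charge_beta_set multipartitions_nth by blast
      have "0 \<le> D * (int N + 1)" using \<open>0 < D\<close> by simp
      from has_charge_0_bounds[OF charge this] near_periodic_bound[OF N[OF \<Lambda>] \<open>0 < D\<close> period]
      show ?thesis by blast
    qed
    then show ?thesis by blast
  qed
  obtain k t u j where "k < l" "t \<in> T" "u \<in> T" "j < l" and k: "\<forall>j<l. c t ! j \<le> c t ! k"
    and "c u ! k < c u ! j"
    using X by (auto simp: condition_X_def sometimes_maximal_def always_maximal_def not_le)
  then obtain K where K: "\<And>\<Lambda>. \<Lambda> \<in> ?C \<Longrightarrow> beta_set (\<Lambda> ! k) \<subseteq> {..<K}"
    using bounded[of t u j k] by (meson less_imp_le)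
  \<comment> \<open>Here the two data swap roles: \<open>u'\<close> puts \<open>m\<close> above
    \<open>j'\<close>, while \<open>t'\<close> makes \<open>m\<close> minimal.\<close>
  obtain m t' u' j' where "m < l" "t' \<in> T" "u' \<in> T" "j' < l" and m: "\<forall>j<l. c t' ! m \<le> c t' ! j"
    and "c u' ! j' < c u' ! m"
    using X by (auto simp: condition_X_def sometimes_minimal_def always_minimal_def not_le)
  then obtain K' where K': "\<And>\<Lambda>. \<Lambda> \<in> ?C \<Longrightarrow> {..< - K'} \<subseteq> beta_set (\<Lambda> ! m)"
    using bounded[of u' t' j' m] by (meson less_imp_le)
  \<comment> \<open>For \<open>t\<close> every component lies inside \<open>k\<close>, for
    \<open>t'\<close> every component contains \<open>m\<close>; undoing the charges gives these
    ends.\<close>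
  define F where "F = (\<Union>i<l. {p \<in> partitions. {..< - K' + c t' ! m - c t' ! i} \<subseteq> beta_set p \<and>
    beta_set p \<subseteq> {..<K + c t ! k - c t ! i}})"
  have "\<Lambda> ! i \<in> F" if \<Lambda>: "\<Lambda> \<in> ?C" and "i < l" for \<Lambda> i
  proof -
    have ch: "chained l (c t) \<Lambda>" "chained l (c t') \<Lambda>" using \<Lambda> \<open>t \<in> T\<close> \<open>t' \<in> T\<close> by auto
    have "x < K + c t ! k - c t ! i" if "x \<in> beta_set (\<Lambda> ! i)" for x
    proof -
      have "x + c t ! i \<in> charged_beta_set (c t) \<Lambda> i"
        using that by (simp add: charged_beta_set_def translate_def)
      then have "x + c t ! i \<in> charged_beta_set (c t) \<Lambda> k"
        using chainedD[OF ch(1) \<open>k < l\<close> \<open>i < l\<close>] k \<open>i < l\<close> by blast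
      then show ?thesis using K[OF \<Lambda>] by (auto simp: charged_beta_set_def translate_def)
    qed
    moreover have "x \<in> beta_set (\<Lambda> ! i)" if "x < - K' + c t' ! m - c t' ! i" for x
    proof -
      have "x + c t' ! i \<in> charged_beta_set (c t') \<Lambda> m"
        using that K'[OF \<Lambda>] by (auto simp: charged_beta_set_def translate_def)
      then have "x + c t' ! i \<in> charged_beta_set (c t') \<Lambda> i"
        using chainedD[OF ch(2) \<open>i < l\<close> \<open>m < l\<close>] m \<open>i < l\<close> by blast
      then show ?thesis by (simp add: charged_beta_set_def translate_def)
    qed
    moreover have "\<Lambda> ! i \<in> partitions" using \<Lambda> \<open>i < l\<close> multipartitions_nth by blast
    ultimately show ?thesis using \<open>i < l\<close> unfolding F_def by blast
  qed
  then have "?C \<subseteq> {\<Lambda>. set \<Lambda> \<subseteq> F \<and> length \<Lambda> = l}"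
    by (auto simp: multipartitions_def in_set_conv_nth)
  moreover have "finite F" unfolding F_def by (intro finite_UN_I finite_partitions_between) simp
  ultimately show ?thesis using finite_lists_length_eq finite_subset by blast
qed

section \<open>Infinite families of common cores\<close>

lemma infinite_unbounded:
  fixes f :: "'a \<Rightarrow> nat"
  assumes "\<And>n. \<exists>x\<in>S. n \<le> f x" shows "infinite S"
proof
  assume "finite S"
  then obtain N where "\<forall>x\<in>S. f x < N" using finite_nat_set_iff_bounded[of "f ` S"] by auto
  then show False using assms[of N] by force
qed

section \<open>Single rows and single columns\<close>

lemma beta_set_eqI:
  assumes "\<And>a. beta p a \<in> S" "\<And>x. x \<in> S \<Longrightarrow> beta p (f x) = x"
  shows "beta_set p = S"
  unfolding beta_set_def using assms by (metis image_subset_iff rangeI subsetI subset_antisym)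

lemma beta_set_empty: "beta_set (\<lambda>_. 0) = {..<0}"
  by (rule beta_set_eqI[where f = "\<lambda>x. nat (- x - 1)"]) (auto simp: beta_def)

text \<open>Starting from \<open>{..<0}\<close>, a row of length \<open>n\<close> moves the element
  -1 up to \<open>n - 1\<close>; dually, a column of height \<open>n\<close> moves
  \<open>- n\<close> up to 0.\<close>

lemma beta_set_row: "beta_set (\<lambda>a. if a = 0 then n else 0) = insert (int n - 1) {..< - 1}"
  by (rule beta_set_eqI[where f = "\<lambda>x. if x = int n - 1 then 0 else nat (- x - 1)"])
    (auto simp: beta_def)

lemma beta_set_column: "beta_set (\<lambda>a. if a < n then 1 else 0) = {..0} - {- int n}"
  by (rule beta_set_eqI[where f = "\<lambda>x. if - int n < x then nat (- x) else nat (- x - 1)"])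
    (auto simp: beta_def)

lemma empty_partition: "(\<lambda>_. 0) \<in> partitions"
  by (simp add: partitions_def antimono_def)

lemma row_partition: "(\<lambda>a. if a = 0 then n else 0) \<in> partitions"
  by (auto simp: partitions_def antimono_def)

lemma column_partition: "(\<lambda>a. if a < n then 1 else 0) \<in> partitions"
  by (auto simp: partitions_def antimono_def)

text \<open>\<open>P\<close> marks components of top charge for every datum, all carrying the same
  long row. The half-line of an unmarked component has strictly smaller charge, so it fits below the
  element that was moved.\<close>

lemma infinite_rows:
  fixes P :: "nat \<Rightarrow> bool"
  assumes "k < l" "P k"
    and le: "\<And>t i j. t \<in> T \<Longrightarrow> i < l \<Longrightarrow> j < l \<Longrightarrow> P j \<Longrightarrow> c t ! i \<le> c t ! j"
    and less: "\<And>t i j. t \<in> T \<Longrightarrow> i < l \<Longrightarrow> j < l \<Longrightarrow> P j \<Longrightarrow> \<not> P i \<Longrightarrow> c t ! i < c t ! j"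
  shows "infinite {\<Lambda> \<in> multipartitions l. \<forall>t\<in>T. chained l (c t) \<Lambda>}" (is "infinite ?C")
proof (rule infinite_unbounded)
  fix n
  define \<Lambda> :: "ptn list" where "\<Lambda> = map (\<lambda>i. if P i then (\<lambda>a. if a = 0 then n else 0) else (\<lambda>_. 0)) [0..<l]"
  have "\<Lambda> \<in> multipartitions l"
    using row_partition empty_partition by (auto simp: multipartitions_def \<Lambda>_def)
  moreover have "chained l (c t) \<Lambda>" if t: "t \<in> T" for t
    unfolding chained_def
  proof (intro allI impI)
    fix i j assume ij: "i < l" "j < l" "c t ! j \<le> c t ! i"
    show "charged_beta_set (c t) \<Lambda> j \<subseteq> charged_beta_set (c t) \<Lambda> i"
      using le[OF t ij(1,2)] le[OF t ij(2,1)] less[OF t ij(1,2)] less[OF t ij(2,1)] ij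
      by (cases "P i"; cases "P j")
        (auto simp: charged_beta_set_def translate_def \<Lambda>_def beta_set_row beta_set_empty)
  qed
  moreover have "n \<le> (\<Lambda> ! k) 0" using assms(1,2) by (simp add: \<Lambda>_def)
  ultimately show "\<exists>\<Lambda>\<in>?C. n \<le> (\<Lambda> ! k) 0" by blast
qed

text \<open>Marked components now have the bottom charge. Their sets reach up to that charge itself,
  hence fit into every half-line of strictly larger charge.\<close>

lemma infinite_columns:
  fixes P :: "nat \<Rightarrow> bool"
  assumes "k < l" "P k"
    and le: "\<And>t i j. t \<in> T \<Longrightarrow> i < l \<Longrightarrow> j < l \<Longrightarrow> P j \<Longrightarrow> c t ! j \<le> c t ! i"
    and less: "\<And>t i j. t \<in> T \<Longrightarrow> i < l \<Longrightarrow> j < l \<Longrightarrow> P j \<Longrightarrow> \<not> P i \<Longrightarrow> c t ! j < c t ! i"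
  shows "infinite {\<Lambda> \<in> multipartitions l. \<forall>t\<in>T. chained l (c t) \<Lambda>}" (is "infinite ?C")
proof (rule infinite_unbounded)
  fix n
  define \<Lambda> :: "ptn list" where "\<Lambda> = map (\<lambda>i. if P i then (\<lambda>a. if a < n then 1 else 0) else (\<lambda>_. 0)) [0..<l]"
  have "\<Lambda> \<in> multipartitions l"
    using column_partition empty_partition by (auto simp: multipartitions_def \<Lambda>_def)
  moreover have "chained l (c t) \<Lambda>" if t: "t \<in> T" for t
    unfolding chained_def
  proof (intro allI impI)
    fix i j assume ij: "i < l" "j < l" "c t ! j \<le> c t ! i"
    show "charged_beta_set (c t) \<Lambda> j \<subseteq> charged_beta_set (c t) \<Lambda> i"
      using le[OF t ij(1,2)] le[OF t ij(2,1)] less[OF t ij(1,2)] less[OF t ij(2,1)] ij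
      by (cases "P i"; cases "P j")
        (auto simp: charged_beta_set_def translate_def \<Lambda>_def beta_set_column beta_set_empty)
  qed
  moreover have "{a. (\<Lambda> ! k) a \<noteq> 0} = {..<n}" using assms(1,2) by (auto simp: \<Lambda>_def)
  then have "n \<le> card {a. (\<Lambda> ! k) a \<noteq> 0}" by simp
  ultimately show "\<exists>\<Lambda>\<in>?C. n \<le> card {a. (\<Lambda> ! k) a \<noteq> 0}" by blast
qed

text \<open>
  The image of \<open>{..<e}\<close> under the permutation of the integers that adds \<open>p * n\<close> to the multiples
  of \<open>p\<close> and subtracts \<open>p * n\<close> from the numbers congruent to \<open>1\<close>. As this permutation commutes
  with translation by \<open>p\<close>, so does the family of these sets, up to the change of \<open>e\<close>.
\<close>

definition abacus :: "int \<Rightarrow> int \<Rightarrow> int \<Rightarrow> int set" where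
  "abacus p n e = {w. if p dvd w then w < e + p * n else if p dvd w - 1 then w < e - p * n else w < e}"

lemma abacus_mono: "e \<le> e' \<Longrightarrow> abacus p n e \<subseteq> abacus p n e'"
  by (auto simp: abacus_def split: if_splits)

lemma translate_abacus: "translate (p * q) (abacus p n e) = abacus p n (e + p * q)"
proof -
  have "p dvd w - p * q \<longleftrightarrow> p dvd w" for w
    using dvd_add_left_iff[of p "- (p * q)" w] by simp
  moreover have "p dvd w - p * q - 1 \<longleftrightarrow> p dvd w - 1" for w
    using dvd_add_left_iff[of p "- (p * q)" "w - 1"] by (simp add: algebra_simps)
  ultimately show ?thesis by (auto simp: abacus_def translate_def algebra_simps)
qed

lemma dvd_diff_imp_eq:
  fixes a b p :: int
  assumes "p dvd a - b" "\<bar>a - b\<bar> < p" shows "a = b"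
  using dvd_imp_le_int[of "a - b" p] assms by auto

lemma dvd_in_window:
  fixes p :: int
  assumes "0 < p" obtains x where "z \<le> x" "x < z + p" "p dvd x - r"
proof
  show "z \<le> z + (r - z) mod p" "z + (r - z) mod p < z + p" using assms by simp_all
  have "z + (r - z) mod p - r = - (p * ((r - z) div p))"
    by (simp add: minus_mult_div_eq_mod[symmetric])
  then show "p dvd z + (r - z) mod p - r" by simp
qed

text \<open>Raising \<open>n\<close> by one moves a single element: the next multiple of
  \<open>p\<close> comes in and the last number congruent to 1 goes out. The bound
  \<open>2 \<le> p\<close> keeps the two classes apart.\<close>

lemma has_charge_abacus:
  assumes "2 \<le> p" shows "has_charge e (abacus p (int n) e)"
proof (induction n)
  case 0
  have "abacus p (int 0) e = {..<e}" by (auto simp: abacus_def)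
  then show ?case using has_charge_lessThan by simp
next
  case (Suc n)
  have "0 < p" using assms by simp
  have excl: "\<not> p dvd w" if "p dvd w - 1" for w
  proof
    assume "p dvd w"
    from dvd_diff[OF this that] have "p dvd 1" by simp
    then show False using assms by simp
  qed
  obtain x where x: "e + p * int n \<le> x" "x < e + p * int n + p" "p dvd x"
    using dvd_in_window[OF \<open>0 < p\<close>, of "e + p * int n" 0] by auto
  obtain y where y: "e - p * int (Suc n) \<le> y" "y < e - p * int (Suc n) + p" "p dvd y - 1"
    using dvd_in_window[OF \<open>0 < p\<close>] by blast
  have step: "p * int (Suc n) = p * int n + p" by (simp add: algebra_simps)
  have x_uniq: "w = x" if "p dvd w" "e + p * int n \<le> w" "w < e + p * int n + p" for w
    by (rule dvd_diff_imp_eq[OF dvd_diff[OF that(1) x(3)]]) (use x that in linarith)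
  have x_iff: "w < e + p * int (Suc n) \<longleftrightarrow> w < e + p * int n \<or> w = x" if "p dvd w" for w
  proof
    assume w: "w < e + p * int (Suc n)"
    have "w = x" if "e + p * int n \<le> w"
      by (rule x_uniq[OF \<open>p dvd w\<close> that]) (use w step in linarith)
    then show "w < e + p * int n \<or> w = x" by linarith
  next
    assume "w < e + p * int n \<or> w = x"
    then show "w < e + p * int (Suc n)" using x(2) \<open>0 < p\<close> step by linarith
  qed
  have y_uniq: "w = y" if "p dvd w - 1" "e - p * int (Suc n) \<le> w" "w < e - p * int (Suc n) + p" for w
  proof (rule dvd_diff_imp_eq)
    show "p dvd w - y" using dvd_diff[OF that(1) y(3)] by simp
    show "\<bar>w - y\<bar> < p" using y that by linarith
  qed
  have y_iff: "w < e - p * int (Suc n) \<longleftrightarrow> w < e - p * int n \<and> w \<noteq> y" if "p dvd w - 1" for w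
  proof
    assume "w < e - p * int (Suc n)"
    then show "w < e - p * int n \<and> w \<noteq> y" using y(1) \<open>0 < p\<close> step by linarith
  next
    assume w: "w < e - p * int n \<and> w \<noteq> y"
    have "w = y" if "e - p * int (Suc n) \<le> w"
      by (rule y_uniq[OF \<open>p dvd w - 1\<close> that]) (use w step in linarith)
    then show "w < e - p * int (Suc n)" using w by linarith
  qed
  have "w \<in> abacus p (int (Suc n)) e \<longleftrightarrow> w \<in> insert x (abacus p (int n) e - {y})" for w
  proof (cases "p dvd w")
    case True
    then have "w \<noteq> y" using excl[OF y(3)] by blast
    moreover have "w \<in> abacus p (int m) e \<longleftrightarrow> w < e + p * int m" for m
      using True by (simp add: abacus_def)
    ultimately show ?thesis using x_iff[OF True] by blast
  next
    case False
    then have "w \<noteq> x" using x(3) by blast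
    show ?thesis
    proof (cases "p dvd w - 1")
      case True
      then have "w \<in> abacus p (int m) e \<longleftrightarrow> w < e - p * int m" for m
        using False by (simp add: abacus_def)
      then show ?thesis using y_iff[OF True] \<open>w \<noteq> x\<close> by blast
    next
      case False
      then have "w \<in> abacus p (int m) e \<longleftrightarrow> w < e" for m
        using \<open>\<not> p dvd w\<close> by (simp add: abacus_def)
      moreover have "w \<noteq> y" using False y(3) by blast
      ultimately show ?thesis using \<open>w \<noteq> x\<close> by blast
    qed
  qed
  then have "abacus p (int (Suc n)) e = insert x (abacus p (int n) e - {y})" by (rule set_eqI)
  moreover have "x \<notin> abacus p (int n) e" using x by (auto simp: abacus_def)
  moreover have "y \<in> abacus p (int n) e"
    using y excl[OF y(3)] unfolding step by (simp add: abacus_def)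
  ultimately show ?case using has_charge_exchange[OF Suc.IH] by simp
qed

text \<open>After translation, the rows \<open>i\<close> and \<open>j\<close> are abaci displaced by
  a multiple of \<open>p\<close>, which only changes the threshold, and abaci with different
  thresholds are nested.\<close>

lemma infinite_abacus:
  fixes e :: "nat \<Rightarrow> int"
  assumes "l > 0" "2 \<le> p"
    and cong: "\<And>t i j. t \<in> T \<Longrightarrow> i < l \<Longrightarrow> j < l \<Longrightarrow> p dvd c t ! i - e i - (c t ! j - e j)"
  shows "infinite {\<Lambda> \<in> multipartitions l. \<forall>t\<in>T. chained l (c t) \<Lambda>}" (is "infinite ?C")
proof (rule infinite_unbounded)
  fix n :: nat
  have "has_charge 0 (translate (- e i) (abacus p (int (Suc n)) (e i)))" for i
    using has_charge_translate[OF has_charge_abacus[OF assms(2), of "e i" "Suc n"], of "- e i"] by simp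
  then have "\<forall>i. \<exists>q. q \<in> partitions \<and> beta_set q = translate (- e i) (abacus p (int (Suc n)) (e i))"
    using beta_set_surj by metis
  then obtain q where q: "\<And>i. q i \<in> partitions"
    "\<And>i. beta_set (q i) = translate (- e i) (abacus p (int (Suc n)) (e i))" by metis
  define \<Lambda> where "\<Lambda> = map q [0..<l]"
  have "\<Lambda> \<in> multipartitions l" using q(1) by (auto simp: multipartitions_def \<Lambda>_def)
  moreover have "chained l (c t) \<Lambda>" if t: "t \<in> T" for t
    unfolding chained_def
  proof (intro allI impI)
    fix i j assume ij: "i < l" "j < l" "c t ! j \<le> c t ! i"
    obtain d where d: "c t ! i - e i - (c t ! j - e j) = p * d"
      using cong[OF t ij(1,2)] by (auto elim: dvdE)
    have "charged_beta_set (c t) \<Lambda> j = translate (c t ! j - e j) (abacus p (int (Suc n)) (e j))"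
      using ij by (simp add: charged_beta_set_def \<Lambda>_def q(2))
    \<comment> \<open>By the choice of \<open>d\<close>, the new threshold exceeds
      \<open>e j\<close> by \<open>c t ! i - c t ! j\<close>.\<close>
    also have "\<dots> \<subseteq> translate (c t ! j - e j) (abacus p (int (Suc n)) (e i + p * d))"
      using ij(3) d by (intro translate_mono abacus_mono) linarith
    also have "\<dots> = translate (c t ! j - e j + p * d) (abacus p (int (Suc n)) (e i))"
      by (simp flip: translate_abacus)
    also have "c t ! j - e j + p * d = c t ! i - e i" using d by simp
    also have "translate \<dots> (abacus p (int (Suc n)) (e i)) = charged_beta_set (c t) \<Lambda> i"
      using ij by (simp add: charged_beta_set_def \<Lambda>_def q(2))
    finally show "charged_beta_set (c t) \<Lambda> j \<subseteq> charged_beta_set (c t) \<Lambda> i" .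
  qed
  \<comment> \<open>\<open>Suc n\<close> ensures that a multiple \<open>x\<close> of
    \<open>p\<close> at or above \<open>e 0 + p * n\<close> is present; it forces a part of size at
    least \<open>n\<close>.\<close>
  moreover have "n \<le> (\<Lambda> ! 0) 0"
  proof -
    obtain x where x: "e 0 + p * int n \<le> x" "x < e 0 + p * int n + p" "p dvd x"
      using dvd_in_window[of p "e 0 + p * int n" 0] \<open>2 \<le> p\<close> by auto
    then have "x - e 0 \<in> beta_set (q 0)"
      by (simp add: q(2) translate_def abacus_def algebra_simps)
    then obtain a where "x - e 0 = beta (q 0) a" by (auto simp: beta_set_def)
    moreover have "q 0 a \<le> q 0 0" using q(1)[of 0] by (auto simp: partitions_def intro: antimonoD)
    moreover have "int n \<le> p * int n" using \<open>2 \<le> p\<close> mult_right_mono[of 1 p "int n"] by simp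
    ultimately show ?thesis using x(1) \<open>l > 0\<close> by (simp add: beta_def \<Lambda>_def)
  qed
  ultimately show "\<exists>\<Lambda>\<in>?C. n \<le> (\<Lambda> ! 0) 0" by blast
qed

section \<open>Necessity of both conditions, and the equivalence\<close>

theorem theorem3p4:
  fixes l :: nat and T :: "'t set" and c :: "'t \<Rightarrow> int list"
  assumes "l > 0"
    and "\<And>t. t \<in> T \<Longrightarrow> length (c t) = l"
  shows "finite (common_cores l ((\<lambda>t. (0, c t)) ` T)) \<longleftrightarrow>
    data_gcd l ((\<lambda>t. (0, c t)) ` T) = 1 \<and> condition_X l ((\<lambda>t. (0, c t)) ` T)"
proof
  let ?D = "(\<lambda>t. (0, c t)) ` T"
  assume "finite (common_cores l ?D)"
  then have fin: "finite {\<Lambda> \<in> multipartitions l. \<forall>t\<in>T. chained l (c t) \<Lambda>}"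
    by (simp add: common_cores_eq)
  show "data_gcd l ?D = 1 \<and> condition_X l ?D"
  proof
    show gcd: "data_gcd l ?D = 1"
    proof (rule ccontr)
      assume "data_gcd l ?D \<noteq> 1"
      \<comment> \<open>If the gcd is 0, all generators vanish and any modulus serves; 2 is the
        least one that \<open>infinite_abacus\<close> admits.\<close>
      define p where "p = (if data_gcd l ?D = 0 then 2 else data_gcd l ?D)"
      have "0 \<le> data_gcd l ?D" by (simp add: data_gcd_def)
      then have "2 \<le> p" using \<open>data_gcd l ?D \<noteq> 1\<close> by (simp add: p_def)
      have p: "p dvd c t ! i - c t ! j - c u ! i + c u ! j"
        if "t \<in> T" "u \<in> T" "i < l" "j < l" for t u i j
      proof -
        have "data_gcd l ?D dvd c t ! i - c t ! j - c u ! i + c u ! j"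
          unfolding data_gcd_eq using that by (intro Gcd_dvd) blast
        moreover have "p dvd data_gcd l ?D" by (simp add: p_def)
        ultimately show ?thesis by (rule dvd_trans[rotated])
      qed
      \<comment> \<open>A reference datum; for empty \<open>T\<close> the choice is arbitrary and
        the congruence vacuous.\<close>
      define u where "u = (SOME u. u \<in> T)"
      have "p dvd c t ! i - c u ! i - (c t ! j - c u ! j)" if "t \<in> T" "i < l" "j < l" for t i j
      proof -
        have "u \<in> T" using that(1) unfolding u_def by (rule someI)
        from p[OF that(1) this that(2,3)] have "p dvd c t ! i - c t ! j - c u ! i + c u ! j" .
        also have "\<dots> = c t ! i - c u ! i - (c t ! j - c u ! j)" by simp
        finally show ?thesis .
      qed
      then have "infinite {\<Lambda> \<in> multipartitions l. \<forall>t\<in>T. chained l (c t) \<Lambda>}"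
        by (rule infinite_abacus[where e = "\<lambda>i. c u ! i", OF \<open>l > 0\<close> \<open>2 \<le> p\<close>])
      then show False using fin by simp
    qed
    \<comment> \<open>An empty \<open>T\<close> would give gcd 0.\<close>
    have "T \<noteq> {}" using gcd by (auto simp: data_gcd_def)
    then obtain t where "t \<in> T" by blast
    have "{..<l} \<noteq> {}" using \<open>l > 0\<close> by auto
    show "condition_X l ?D"
      unfolding condition_X_def
    proof (intro conjI; rule ccontr)
      assume "\<not> (\<exists>k<l. sometimes_maximal l ?D k \<and> \<not> always_maximal l ?D k)"
      moreover have "sometimes_maximal l ?D k" if "t \<in> T" "\<forall>j<l. c t ! j \<le> c t ! k" for k t
        unfolding sometimes_maximal_def using that by (intro bexI[of _ "(0, c t)"]) auto
      ultimately have always: "always_maximal l ?D k" if "k < l" "t \<in> T" "\<forall>j<l. c t ! j \<le> c t ! k" for k t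
        using that by blast
      obtain k where "k < l" "\<forall>j<l. c t ! j \<le> c t ! k"
        using finite_argmax[of "{..<l}" "(!) (c t)"] \<open>{..<l} \<noteq> {}\<close> by auto
      then have k: "k < l" "always_maximal l ?D k" using always \<open>t \<in> T\<close> by blast+
      have le: "c t ! i \<le> c t ! j" if "t \<in> T" "i < l" "j < l" "always_maximal l ?D j" for t i j
        using that by (auto simp: always_maximal_def)
      \<comment> \<open>A component tied at \<open>t\<close> with an always maximal one would itself
        be sometimes, hence always, maximal.\<close>
      have less: "c t ! i < c t ! j"
        if "t \<in> T" "i < l" "j < l" "always_maximal l ?D j" "\<not> always_maximal l ?D i" for t i j
      proof (rule ccontr)
        assume "\<not> ?thesis"
        then have "\<forall>j<l. c t ! j \<le> c t ! i" using le[OF that(1) _ that(3,4)] by force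
        then show False using always[OF that(2,1)] that(5) by blast
      qed
      have "infinite {\<Lambda> \<in> multipartitions l. \<forall>t\<in>T. chained l (c t) \<Lambda>}"
        by (rule infinite_rows[where P = "always_maximal l ?D", OF k]) (fact le, fact less)
      then show False using fin by simp
    next
      assume "\<not> (\<exists>k<l. sometimes_minimal l ?D k \<and> \<not> always_minimal l ?D k)"
      moreover have "sometimes_minimal l ?D k" if "t \<in> T" "\<forall>j<l. c t ! k \<le> c t ! j" for k t
        unfolding sometimes_minimal_def using that by (intro bexI[of _ "(0, c t)"]) auto
      ultimately have always: "always_minimal l ?D k" if "k < l" "t \<in> T" "\<forall>j<l. c t ! k \<le> c t ! j" for k t
        using that by blast
      obtain k where "k < l" "\<forall>j<l. c t ! k \<le> c t ! j"
        using finite_argmax[of "{..<l}" "\<lambda>j. - c t ! j"] \<open>{..<l} \<noteq> {}\<close> by auto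
      then have k: "k < l" "always_minimal l ?D k" using always \<open>t \<in> T\<close> by blast+
      have le: "c t ! j \<le> c t ! i" if "t \<in> T" "i < l" "j < l" "always_minimal l ?D j" for t i j
        using that by (auto simp: always_minimal_def)
      have less: "c t ! j < c t ! i"
        if "t \<in> T" "i < l" "j < l" "always_minimal l ?D j" "\<not> always_minimal l ?D i" for t i j
      proof (rule ccontr)
        assume "\<not> ?thesis"
        then have "\<forall>j<l. c t ! i \<le> c t ! j" using le[OF that(1) _ that(3,4)] by force
        then show False using always[OF that(2,1)] that(5) by blast
      qed
      have "infinite {\<Lambda> \<in> multipartitions l. \<forall>t\<in>T. chained l (c t) \<Lambda>}"
        by (rule infinite_columns[where P = "always_minimal l ?D", OF k]) (fact le, fact less)
      then show False using fin by simp
    qed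
  qed
next
  assume "data_gcd l ((\<lambda>t. (0, c t)) ` T) = 1 \<and> condition_X l ((\<lambda>t. (0, c t)) ` T)"
  then show "finite (common_cores l ((\<lambda>t. (0, c t)) ` T))"
    unfolding common_cores_eq using finite_common_cores by blast
qed

end
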